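(* Let $G_1$ and $G_2$ be graphs and let $H = G_1 \circ G_2$. Then every special subgraph of $H$ is word-representable.
   Context: All graphs are simple, undirected and finite. A graph $G$ is word-representable if there is a word $w$ over the alphabet $V(G)$ such that for all distinct $x,y \in V(G)$, $xy \in E(G)$ iff the occurrences of $x$ and $y$ alternate in $w$. A comparability graph is a graph admitting a transitive orientation. The lexicographic product $H = G_1 \circ G_2$ has vertex set $V(G_1)\times V(G_2)$, with $(u,v)$ and $(x,y)$ adjacent iff $\{u,x\}\in E(G_1)$, or $u=x$ and $\{v,y\}\in E(G_2)$. For $v_i \in V(G_1)$ the supervertex $V_i = \{(v_i,u) : u \in V(G_2)\}$. For a subgraph $G_1'$ of $G_1$, the lexicographic map $\mathcal{L}_H(G_1')$ is the subgraph of $H$ on vertex set $V(H)$ with no edges inside any supervertex and, for each edge $v_iv_j \in E(G_1')$, all edges between $V_i$ and $V_j$. A special subgraph of $H$ is any subgraph of $H$ obtained, for some word-representable subgraph $G_1'$ of $G_1$, from $\mathcal{L}_H(G_1')$ by adding edges of $H$ inside each supervertex $V_i$ such that the graph formed on $V_i$ by these added edges is a comparability graph (possibly with isolated vertices). *)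

theory Defs
  imports "Graph_Theory.Pair_Digraph" "Graph_Theory.Digraph_Component"
begin

text \<open>
  A finite simple undirected graph is a \<^locale>\<open>pair_graph\<close>: finite, loop-free, and with a
  symmetric set of arcs, so that the edge \<open>{x, y}\<close> is the pair of arcs \<open>(x, y)\<close>, \<open>(y, x)\<close>.
\<close>

text \<open>
  Deleting from \<open>w\<close> all letters other than \<open>x\<close> and \<open>y\<close> leaves \<open>xyxy\<dots>\<close> or \<open>yxyx\<dots>\<close>
  (of even or odd length).
\<close>

definition alternate :: "'a list \<Rightarrow> 'a \<Rightarrow> 'a \<Rightarrow> bool" where
  "alternate w x y \<longleftrightarrow> distinct_adj (filter (\<lambda>z. z = x \<or> z = y) w)"

text \<open>
  By the usual convention, a word representing a graph contains every vertex at least once.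
\<close>

definition represents :: "'a list \<Rightarrow> 'a pair_pre_digraph \<Rightarrow> bool" where
  "represents w G \<longleftrightarrow> set w = pverts G \<and>
     (\<forall>x\<in>pverts G. \<forall>y\<in>pverts G. x \<noteq> y \<longrightarrow> ((x, y) \<in> parcs G \<longleftrightarrow> alternate w x y))"

definition word_representable :: "'a pair_pre_digraph \<Rightarrow> bool" where
  "word_representable G \<longleftrightarrow> (\<exists>w. represents w G)"

definition orientation :: "'a rel \<Rightarrow> 'a pair_pre_digraph \<Rightarrow> bool" where
  "orientation D G \<longleftrightarrow> D \<union> D\<inverse> = parcs G \<and> D \<inter> D\<inverse> = {}"

definition comparability_graph :: "'a pair_pre_digraph \<Rightarrow> bool" where
  "comparability_graph G \<longleftrightarrow> pair_graph G \<and> (\<exists>D. orientation D G \<and> trans D)"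

definition lex_product ::
  "'a pair_pre_digraph \<Rightarrow> 'b pair_pre_digraph \<Rightarrow> ('a \<times> 'b) pair_pre_digraph" where
  "lex_product G1 G2 = \<lparr>
     pverts = pverts G1 \<times> pverts G2,
     parcs = {((u, v), (x, y)) | u v x y.
       (u, v) \<in> pverts G1 \<times> pverts G2 \<and> (x, y) \<in> pverts G1 \<times> pverts G2 \<and>
       ((u, x) \<in> parcs G1 \<or> u = x \<and> (v, y) \<in> parcs G2)} \<rparr>"

definition supervertex :: "'b pair_pre_digraph \<Rightarrow> 'a \<Rightarrow> ('a \<times> 'b) set" where
  "supervertex G2 v = {(v, u) | u. u \<in> pverts G2}"

text \<open>
  The lexicographic map of a subgraph \<open>G1'\<close> of \<open>G1\<close>. Its vertex set is that of the whole product,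
  also when \<open>G1'\<close> does not contain all vertices of \<open>G1\<close>.
\<close>

definition lex_map ::
  "'a pair_pre_digraph \<Rightarrow> 'b pair_pre_digraph \<Rightarrow> 'a pair_pre_digraph \<Rightarrow>
     ('a \<times> 'b) pair_pre_digraph" where
  "lex_map G1 G2 G1' = \<lparr>
     pverts = pverts (lex_product G1 G2),
     parcs = (\<Union>(vi, vj)\<in>parcs G1'. supervertex G2 vi \<times> supervertex G2 vj) \<rparr>"

text \<open>
  \<open>F v\<close> is the graph formed by the added edges on the supervertex of \<open>v\<close>.
\<close>

definition special_subgraph ::
  "'a pair_pre_digraph \<Rightarrow> 'b pair_pre_digraph \<Rightarrow> ('a \<times> 'b) pair_pre_digraph \<Rightarrow> bool" where
  "special_subgraph G1 G2 S \<longleftrightarrow>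
     pair_graph S \<and> subgraph (with_proj S) (with_proj (lex_product G1 G2)) \<and>
     (\<exists>G1' F.
        pair_graph G1' \<and> subgraph (with_proj G1') (with_proj G1) \<and> word_representable G1' \<and>
        (\<forall>v\<in>pverts G1. pverts (F v) = supervertex G2 v \<and>
           subgraph (with_proj (F v)) (with_proj (lex_product G1 G2)) \<and> comparability_graph (F v)) \<and>
        pverts S = pverts (lex_map G1 G2 G1') \<and>
        parcs S = parcs (lex_map G1 G2 G1') \<union> (\<Union>v\<in>pverts G1. parcs (F v)))"

lemma pair_graph_lex_product:
  assumes "pair_graph G1" "pair_graph G2"
  shows "pair_graph (lex_product G1 G2)"
proof -
  interpret G1: pair_graph G1 by fact
  interpret G2: pair_graph G2 by fact
  have "parcs (lex_product G1 G2)
      \<subseteq> (pverts G1 \<times> pverts G2) \<times> (pverts G1 \<times> pverts G2)"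
    by (auto simp: lex_product_def)
  then have "finite (parcs (lex_product G1 G2))"
    by (rule finite_subset) (simp add: G1.pair_finite_verts G2.pair_finite_verts)
  moreover have "sym (parcs (lex_product G1 G2))"
    by (rule symI)
      (auto simp: lex_product_def intro: G1.arcs_symmetric G2.arcs_symmetric)
  ultimately show ?thesis
    by unfold_locales
      (auto simp: lex_product_def symmetric_def G1.pair_finite_verts G2.pair_finite_verts
        dest: G1.no_loops' G2.no_loops')
qed

end

theory Submission
  imports Defs
begin

text \<open>
  Take a word for \<open>G1'\<close> and replace every occurrence of a vertex \<open>v\<close> by a permutation of its
  supervertex. Two letters of different supervertices then alternate exactly when their first
  components do. Two letters of the same supervertex alternate exactly when all permutations
  inserted for it order them in the same way; if these permutations run through all linear
  extensions of a transitive orientation of the graph on the supervertex, this happens exactly for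
  the comparable, i.e. adjacent, pairs. Enough room for all the linear extensions is obtained by
  appending to a word, as often as needed, its letters in the order of their last occurrences,
  which does not affect alternation.
\<close>

section \<open>Duplicate-free lists restricted to two letters\<close>

lemma distinct_filter_pair:
  assumes "distinct l" "x \<in> set l" "y \<in> set l" "x \<noteq> y"
  shows "filter (\<lambda>z. z = x \<or> z = y) l \<in> {[x, y], [y, x]}"
proof -
  let ?l = "filter (\<lambda>z. z = x \<or> z = y) l"
  have s: "set ?l = {x, y}" and d: "distinct ?l"
    using assms by auto
  then have "length ?l = 2"
    using distinct_card[OF d] assms(4) by simp
  then obtain a b where "?l = [a, b]"
    by (auto simp: length_Suc_conv numeral_2_eq_2)
  with s d show ?thesis
    by (auto simp: doubleton_eq_iff)
qed

lemma distinct_filter_single: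
  assumes "distinct l" "x \<in> set l" "y \<notin> set l"
  shows "filter (\<lambda>z. z = x \<or> z = y) l = [x]"
proof -
  have "filter (\<lambda>z. z = x \<or> z = y) l = filter (\<lambda>z. z = x) l"
    using assms(3) by (intro filter_cong) auto
  also have "\<dots> = [x]"
    using assms(1,2) by (induction l) (auto simp: filter_empty_conv)
  finally show ?thesis .
qed

subsection \<open>Linear extensions\<close>

text \<open>The condition is negative so that incomparable elements may come in either order. It is
  antitone in \<open>D\<close>: a linear extension of a larger relation also serves a smaller
  one.\<close>

definition linear_extension :: "'a set \<Rightarrow> 'a rel \<Rightarrow> 'a list \<Rightarrow> bool" where
  "linear_extension V D l \<longleftrightarrow> distinct l \<and> set l = V \<and> sorted_wrt (\<lambda>a b. (b, a) \<notin> D) l"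

text \<open>Topological sorting: a minimal element goes first, the rest follows by induction.
  Acyclicity is assumed instead of transitivity because \<open>D\<close> will be a transitive
  relation enlarged by one pair.\<close>

lemma ex_linear_extension:
  assumes "finite V" "acyclic D"
  shows "\<exists>l. linear_extension V D l"
  using assms(1)
proof (induction V rule: finite_psubset_induct)
  case (psubset V)
  show ?case
  proof (cases "V = {}")
    case True
    then show ?thesis by (auto simp: linear_extension_def)
  next
    case False
    let ?D = "D \<inter> V \<times> V"
    have "wf ?D"
      using psubset.hyps assms(2) by (intro finite_acyclic_wf) (auto intro: acyclic_subset)
    moreover obtain z where "z \<in> V"
      using False by blast
    ultimately obtain m where "m \<in> V" "\<And>a. (a, m) \<in> ?D \<Longrightarrow> a \<notin> V"
      by (rule wfE_min) blast
    then have m: "m \<in> V" "\<forall>a\<in>V. (a, m) \<notin> D"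
      by blast+
    obtain l where "linear_extension (V - {m}) D l"
      using psubset.IH[of "V - {m}"] m(1) by auto
    then have "linear_extension V D (m # l)"
      using m by (auto simp: linear_extension_def)
    then show ?thesis ..
  qed
qed

lemma linear_extension_filter:
  assumes "linear_extension V D l" "(x, y) \<in> D" "x \<in> V" "y \<in> V" "x \<noteq> y"
  shows "filter (\<lambda>z. z = x \<or> z = y) l = [x, y]"
proof -
  have "sorted_wrt (\<lambda>a b. (b, a) \<notin> D) (filter (\<lambda>z. z = x \<or> z = y) l)"
    using assms(1) by (auto simp: linear_extension_def sorted_wrt_filter)
  moreover have "filter (\<lambda>z. z = x \<or> z = y) l \<in> {[x, y], [y, x]}"
    using assms by (intro distinct_filter_pair) (auto simp: linear_extension_def)
  ultimately show ?thesis
    using assms(2) by auto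
qed

text \<open>A cycle created by adding \<open>(x, y)\<close> to \<open>D\<close> would need a path
  from \<open>y\<close> to \<open>x\<close> in \<open>D\<close>, hence by transitivity the pair
  \<open>(y, x)\<close> itself. So the enlarged relation has a linear extension, and this one puts
  \<open>x\<close> first.\<close>

lemma ex_linear_extension_filter:
  assumes "finite V" "trans D" "irrefl D" "(y, x) \<notin> D" "x \<in> V" "y \<in> V" "x \<noteq> y"
  shows "\<exists>l. linear_extension V D l \<and> filter (\<lambda>z. z = x \<or> z = y) l = [x, y]"
proof -
  have "acyclic D"
    using assms(2,3) by (simp add: acyclic_irrefl)
  moreover have "(y, x) \<notin> D\<^sup>*"
    using assms(2,4,7) by (metis rtrancl_eq_or_trancl trancl_id)
  ultimately have "acyclic (insert (x, y) D)"
    by simp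
  then obtain l where l: "linear_extension V (insert (x, y) D) l"
    using ex_linear_extension[OF assms(1)] by blast
  then have "linear_extension V D l"
    using sorted_wrt_mono_rel[of l "\<lambda>a b. (b, a) \<notin> insert (x, y) D" "\<lambda>a b. (b, a) \<notin> D"]
    by (simp add: linear_extension_def)
  moreover have "filter (\<lambda>z. z = x \<or> z = y) l = [x, y]"
    using linear_extension_filter[OF l] assms by auto
  ultimately show ?thesis by blast
qed

section \<open>Permutational representation of comparability graphs\<close>

text \<open>The equivalence is required for all \<open>n\<close> from \<open>N\<close> on, because
  the number of occurrences of a vertex in the word to be inflated is only bounded from
  below.\<close>

definition permutationally_represents :: "(nat \<Rightarrow> 'a list) \<Rightarrow> nat \<Rightarrow> 'a pair_pre_digraph \<Rightarrow> bool" where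
  "permutationally_represents p N G \<longleftrightarrow>
    (\<forall>k. distinct (p k) \<and> set (p k) = pverts G) \<and>
    (\<forall>x\<in>pverts G. \<forall>y\<in>pverts G. \<forall>n\<ge>N. x \<noteq> y \<longrightarrow>
      ((x, y) \<in> parcs G \<longleftrightarrow>
        (\<forall>j<n. \<forall>k<n. filter (\<lambda>z. z = x \<or> z = y) (p j) = filter (\<lambda>z. z = x \<or> z = y) (p k))))"

text \<open>All linear extensions of a transitive orientation agree on a pair of distinct vertices
  exactly if the pair is comparable, that is, adjacent.\<close>

lemma comparability_graph_permutationally_represented:
  assumes "comparability_graph G"
  shows "\<exists>p N. permutationally_represents p N G"
proof -
  interpret pair_graph G
    using assms by (simp add: comparability_graph_def)
  obtain D where D: "D \<union> D\<inverse> = parcs G" "D \<inter> D\<inverse> = {}" "trans D"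
    using assms by (auto simp: comparability_graph_def orientation_def)
  have "irrefl D"
    using D(2) by (auto simp: irrefl_def)
  define E where "E = {l. linear_extension (pverts G) D l}"
  have "finite E"
    by (rule finite_subset[OF _ finite_subset_distinct[OF pair_finite_verts]])
      (auto simp: E_def linear_extension_def)
  then obtain ls where ls: "set ls = E"
    using finite_list by blast
  have "acyclic D"
    using D(3) \<open>irrefl D\<close> by (simp add: acyclic_irrefl)
  then have "E \<noteq> {}"
    using ex_linear_extension[OF pair_finite_verts] by (auto simp: E_def)
  then have "ls \<noteq> []"
    using ls by auto
  \<comment> \<open>Cyclic repetition makes the sequence infinite, while its first
    \<open>length ls\<close> entries already exhaust \<open>E\<close>.\<close>
  define p where "p k = ls ! (k mod length ls)" for k
  have p: "linear_extension (pverts G) D (p k)" for k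
    using ls \<open>ls \<noteq> []\<close> nth_mem[of "k mod length ls" ls] by (auto simp: p_def E_def)
  have p_ex: "\<exists>k<length ls. p k = l" if "linear_extension (pverts G) D l" for l
  proof -
    have "l \<in> set ls"
      using that ls by (simp add: E_def)
    then show ?thesis
      by (metis in_set_conv_nth mod_less p_def)
  qed
  show ?thesis
    unfolding permutationally_represents_def
  proof (intro exI[of _ p] exI[of _ "length ls"] conjI allI ballI impI)
    fix x y n
    assume xy: "x \<in> pverts G" "y \<in> pverts G" "x \<noteq> y" and n: "length ls \<le> n"
    let ?f = "\<lambda>k. filter (\<lambda>z. z = x \<or> z = y) (p k)"
    have swap: "filter (\<lambda>z. z = y \<or> z = x) l = filter (\<lambda>z. z = x \<or> z = y) l" for l
      by (intro filter_cong) auto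
    show "(x, y) \<in> parcs G \<longleftrightarrow> (\<forall>j<n. \<forall>k<n. ?f j = ?f k)"
    proof
      assume "(x, y) \<in> parcs G"
      then have "(x, y) \<in> D \<or> (y, x) \<in> D"
        using D(1) by auto
      then show "\<forall>j<n. \<forall>k<n. ?f j = ?f k"
        using linear_extension_filter[OF p, of x y] linear_extension_filter[OF p, of y x] xy swap
        by auto
    next
      assume same: "\<forall>j<n. \<forall>k<n. ?f j = ?f k"
      show "(x, y) \<in> parcs G"
      proof (rule ccontr)
        assume "(x, y) \<notin> parcs G"
        then have "(x, y) \<notin> D" "(y, x) \<notin> D"
          using D(1) by auto
        \<comment> \<open>An incomparable pair is ordered in opposite ways by two linear extensions,
          both of which occur below \<open>length ls\<close>.\<close>
        then obtain l l' where
          "linear_extension (pverts G) D l" "filter (\<lambda>z. z = x \<or> z = y) l = [x, y]"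
          "linear_extension (pverts G) D l'" "filter (\<lambda>z. z = x \<or> z = y) l' = [y, x]"
          using ex_linear_extension_filter[OF pair_finite_verts D(3) \<open>irrefl D\<close>, of y x]
            ex_linear_extension_filter[OF pair_finite_verts D(3) \<open>irrefl D\<close>, of x y] xy swap
          by metis
        with p_ex obtain j k where "j < length ls" "k < length ls" "?f j = [x, y]" "?f k = [y, x]"
          by metis
        moreover from this have "?f j = ?f k"
          using same n by (meson order_less_le_trans)
        ultimately show False
          using xy(3) by simp
      qed
    qed
  next
    show "distinct (p k)" "set (p k) = pverts G" for k
      using p[of k] by (simp_all add: linear_extension_def)
  qed
qed

subsection \<open>Words with many occurrences of every letter\<close>

text \<open>\<open>remdups\<close> keeps last occurrences. An alternating \<open>u\<close> that ends
  in \<open>a\<close>, \<open>b\<close> thus has \<open>remdups u = [a, b]\<close>, which continues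
  the alternation.\<close>

lemma distinct_adj_append_remdups:
  assumes "set u = {x, y}" "x \<noteq> y"
  shows "distinct_adj (u @ remdups u) \<longleftrightarrow> distinct_adj u"
proof
  assume u: "distinct_adj u"
  obtain v b where "u = v @ [b]"
    using assms(1) by (metis insert_not_empty list.set(1) rev_exhaust)
  moreover obtain v' a where "v = v' @ [a]"
    using assms calculation by (cases v rule: rev_cases) auto
  ultimately have uab: "u = v' @ [a, b]"
    by simp
  then have "a \<noteq> b"
    using u by auto
  have ab: "{a, b} = {x, y}"
  proof (rule card_seteq)
    show "{a, b} \<subseteq> {x, y}" "card {x, y} \<le> card {a, b}"
      using assms uab \<open>a \<noteq> b\<close> by auto
  qed simp
  have "remdups (t @ [a, b]) = [a, b]" if "set t \<subseteq> {a, b}" for t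
    using that \<open>a \<noteq> b\<close> by (induction t) auto
  then have "remdups u = [a, b]"
    using uab ab assms(1) by auto
  then show "distinct_adj (u @ remdups u)"
    using u uab \<open>a \<noteq> b\<close> by (simp add: distinct_adj_append_iff)
qed (auto simp: distinct_adj_append_iff)

lemma represents_append_remdups:
  assumes "represents w G"
  shows "represents (w @ remdups w) G"
proof -
  have "alternate (w @ remdups w) x y \<longleftrightarrow> alternate w x y"
    if "x \<in> set w" "y \<in> set w" "x \<noteq> y" for x y
    using distinct_adj_append_remdups[of "filter (\<lambda>z. z = x \<or> z = y) w" x y] that
    by (auto simp: alternate_def remdups_filter)
  then show ?thesis
    using assms by (auto simp: represents_def)
qed

lemma ex_represents_count_ge:
  assumes "represents w G"
  shows "\<exists>w'. represents w' G \<and> (\<forall>v\<in>pverts G. N \<le> count_list w' v)"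
proof (induction N)
  case 0
  then show ?case using assms by auto
next
  case (Suc N)
  then obtain w' where w': "represents w' G" "\<forall>v\<in>pverts G. N \<le> count_list w' v"
    by auto
  have "0 < count_list (remdups w') v" if "v \<in> pverts G" for v
    using w'(1) that count_list_0_iff[of "remdups w'" v]
    by (auto simp: represents_def)
  then have "\<forall>v\<in>pverts G. Suc N \<le> count_list (w' @ remdups w') v"
    using w'(2) by (fastforce simp: count_list_append)
  then show ?case
    using represents_append_remdups[OF w'(1)] by blast
qed

text \<open>Needed because \<open>G1'\<close> may omit vertices of \<open>G1\<close> whose
  supervertices still belong to the special subgraph.\<close>

lemma word_representable_add_isolated:
  assumes "word_representable G" "parcs G \<subseteq> pverts G \<times> pverts G" "finite U"
  shows "word_representable \<lparr>pverts = pverts G \<union> U, parcs = parcs G\<rparr>"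
  using assms(3)
proof (induction U)
  case empty
  then show ?case using assms(1) by (cases G) simp
next
  case (insert z U)
  show ?case
  proof (cases "z \<in> pverts G")
    case True
    then show ?thesis
      using insert.IH by (simp add: insert_absorb)
  next
    case False
    obtain w where w: "represents w \<lparr>pverts = pverts G \<union> U, parcs = parcs G\<rparr>"
      using insert.IH by (auto simp: word_representable_def)
    \<comment> \<open>The doubled \<open>z\<close> spoils its alternation with every other letter
      and is invisible to all other pairs.\<close>
    have "represents (z # z # w) \<lparr>pverts = pverts G \<union> insert z U, parcs = parcs G\<rparr>"
      using w assms(2) False insert.hyps(2)
      by (auto simp: represents_def alternate_def)
    then show ?thesis
      by (auto simp: word_representable_def)
  qed
qed

subsection \<open>Substituting blocks for letters\<close>

text \<open>
  The index of a block is the number of later occurrences of its letter, so the occurrences of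
  \<open>v\<close> receive the blocks with indices \<open>count_list w v - 1, \<dots>, 0\<close> in this order.
\<close>

fun inflate :: "('a \<Rightarrow> nat \<Rightarrow> 'b list) \<Rightarrow> 'a list \<Rightarrow> 'b list" where
  "inflate P [] = []"
| "inflate P (v # w) = P v (count_list w v) @ inflate P w"

lemma set_inflate:
  assumes "\<And>v k. v \<in> set w \<Longrightarrow> set (P v k) = V v"
  shows "set (inflate P w) = (\<Union>v\<in>set w. V v)"
  using assms by (induction w) auto

text \<open>Each block of \<open>i\<close> contributes one \<open>x\<close> and each block of
  \<open>j\<close> one \<open>y\<close>, so the restriction to \<open>x\<close>, \<open>y\<close> is
  an injective renaming of the restriction of \<open>w\<close> to \<open>i\<close>,
  \<open>j\<close>.\<close>

lemma alternate_inflate_distinct_blocks: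
  assumes "\<And>v k. v \<in> set w \<Longrightarrow> distinct (P v k)" "\<And>v k. v \<in> set w \<Longrightarrow> set (P v k) = V v"
    and "disjoint_family_on V (set w)"
    and "i \<in> set w" "j \<in> set w" "i \<noteq> j" "x \<in> V i" "y \<in> V j"
  shows "alternate (inflate P w) x y \<longleftrightarrow> alternate w i j"
proof -
  have "x \<noteq> y" and x: "\<And>v. v \<in> set w \<Longrightarrow> x \<in> V v \<longleftrightarrow> v = i"
    and y: "\<And>v. v \<in> set w \<Longrightarrow> y \<in> V v \<longleftrightarrow> v = j"
    using assms(3-) unfolding disjoint_family_on_def by blast+
  let ?f = "filter (\<lambda>z. z = x \<or> z = y)" and ?r = "\<lambda>v. if v = i then x else y"
  have block: "?f (P v k) = (if v = i \<or> v = j then [?r v] else [])" if "v \<in> set w" for v k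
  proof -
    have "?f (P v k) = [x]" if "v = i"
      using distinct_filter_single[of "P v k" x y] assms x y that by simp
    moreover have "?f (P v k) = [y]" if "v = j"
      using distinct_filter_single[of "P v k" y x] assms x y that by (simp add: disj_commute)
    moreover have "?f (P v k) = []" if "v \<noteq> i" "v \<noteq> j"
      using assms(2) x y that \<open>v \<in> set w\<close> by (auto simp: filter_empty_conv)
    ultimately show ?thesis
      using assms(6) by auto
  qed
  have "?f (inflate P w) = map ?r (filter (\<lambda>v. v = i \<or> v = j) w)"
    using block by (induction w) auto
  moreover have "inj_on ?r (set (filter (\<lambda>v. v = i \<or> v = j) w))"
    using \<open>x \<noteq> y\<close> by (auto simp: inj_on_def)
  ultimately show ?thesis
    by (simp add: alternate_def distinct_adj_map_iff)
qed

lemma filter_inflate_block: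
  assumes "\<And>v k. v \<in> set w \<Longrightarrow> v \<noteq> i \<Longrightarrow> filter Q (P v k) = []"
  shows "filter Q (inflate P w)
    = concat (map (\<lambda>k. filter Q (P i k)) (rev [0..<count_list w i]))"
  using assms by (induction w) auto

text \<open>Two neighbouring pairs clash at their border exactly if they differ, so alternation
  forces all of them to be equal.\<close>

lemma distinct_adj_concat_pairs:
  assumes "set ps \<subseteq> {[x, y], [y, x]}" "x \<noteq> y"
  shows "distinct_adj (concat ps) \<longleftrightarrow> (\<forall>p\<in>set ps. \<forall>q\<in>set ps. p = q)"
  using assms(1)
proof (induction ps)
  case (Cons p ps)
  show ?case
  proof (cases ps)
    case Nil
    then show ?thesis using Cons.prems assms(2) by auto
  next
    case (Cons q qs)
    then have "distinct_adj (concat (p # ps)) \<longleftrightarrow> p = q \<and> distinct_adj (concat ps)"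
      using Cons.prems assms(2) by auto
    then show ?thesis
      using Cons.IH Cons.prems Cons by auto
  qed
qed simp

text \<open>By disjointness only the blocks of \<open>i\<close> contain \<open>x\<close> or
  \<open>y\<close>, and their indices are exactly the numbers below
  \<open>count_list w i\<close>.\<close>

lemma alternate_inflate_same_block:
  assumes "\<And>v k. v \<in> set w \<Longrightarrow> distinct (P v k)" "\<And>v k. v \<in> set w \<Longrightarrow> set (P v k) = V v"
    and "disjoint_family_on V (set w)"
    and "i \<in> set w" "x \<in> V i" "y \<in> V i" "x \<noteq> y"
  shows "alternate (inflate P w) x y \<longleftrightarrow>
    (\<forall>j<count_list w i. \<forall>k<count_list w i.
      filter (\<lambda>z. z = x \<or> z = y) (P i j) = filter (\<lambda>z. z = x \<or> z = y) (P i k))"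
proof -
  let ?f = "filter (\<lambda>z. z = x \<or> z = y)"
  let ?ps = "map (\<lambda>k. ?f (P i k)) (rev [0..<count_list w i])"
  have "?f (P v k) = []" if "v \<in> set w" "v \<noteq> i" for v k
    using assms that unfolding filter_empty_conv disjoint_family_on_def by blast
  then have "?f (inflate P w) = concat ?ps"
    by (rule filter_inflate_block)
  moreover have "set ?ps \<subseteq> {[x, y], [y, x]}"
  proof -
    have "?f (P i k) \<in> {[x, y], [y, x]}" for k
      using assms by (intro distinct_filter_pair) auto
    then show ?thesis by auto
  qed
  ultimately have "alternate (inflate P w) x y \<longleftrightarrow> (\<forall>p\<in>set ?ps. \<forall>q\<in>set ?ps. p = q)"
    using distinct_adj_concat_pairs[of ?ps x y] assms(7)
    unfolding alternate_def by presburger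
  also have "\<dots> \<longleftrightarrow> (\<forall>j\<in>{..<count_list w i}. \<forall>k\<in>{..<count_list w i}. ?f (P i j) = ?f (P i k))"
    by (simp only: set_map set_rev set_upt atLeast0LessThan ball_simps)
  finally show ?thesis
    by (simp only: Ball_def lessThan_iff)
qed

section \<open>Inflating a word for the special subgraph\<close>

theorem theorem6:
  fixes G1 :: "'a pair_pre_digraph" and G2 :: "'b pair_pre_digraph"
    and S :: "('a \<times> 'b) pair_pre_digraph"
  assumes "pair_graph G1" and "pair_graph G2"
    and "special_subgraph G1 G2 S"
  shows "word_representable S"
proof -
  interpret G1: pair_graph G1 by fact
  obtain G1' F where G1': "pair_graph G1'" "subgraph (with_proj G1') (with_proj G1)"
      "word_representable G1'"
    and F: "\<And>v. v \<in> pverts G1 \<Longrightarrow> pverts (F v) = supervertex G2 v"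
      "\<And>v. v \<in> pverts G1 \<Longrightarrow> comparability_graph (F v)"
    and S: "pverts S = pverts G1 \<times> pverts G2"
      "parcs S = (\<Union>(vi, vj)\<in>parcs G1'. supervertex G2 vi \<times> supervertex G2 vj)
        \<union> (\<Union>v\<in>pverts G1. parcs (F v))"
    using assms(3) by (auto simp: special_subgraph_def lex_map_def lex_product_def)
  interpret G1': pair_graph G1' by fact
  have sub: "pverts G1' \<subseteq> pverts G1"
    using G1'(2) by (auto simp: subgraph_def)
  have wf: "parcs G1' \<subseteq> pverts G1' \<times> pverts G1'"
    by (auto dest: G1'.in_arcsD1 G1'.in_arcsD2)
  have F_arcs: "parcs (F v) \<subseteq> supervertex G2 v \<times> supervertex G2 v" if "v \<in> pverts G1" for v
  proof -
    interpret pair_graph "F v"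
      using F(2)[OF that] by (simp add: comparability_graph_def)
    show ?thesis
      using F(1)[OF that] by (auto dest: in_arcsD1 in_arcsD2)
  qed

  obtain P N where PN: "\<And>v. v \<in> pverts G1 \<Longrightarrow> permutationally_represents (P v) (N v) (F v)"
    using comparability_graph_permutationally_represented[OF F(2)] by metis
  then have P: "\<And>v k. v \<in> pverts G1 \<Longrightarrow> distinct (P v k)"
      "\<And>v k. v \<in> pverts G1 \<Longrightarrow> set (P v k) = supervertex G2 v"
    by (simp_all add: permutationally_represents_def F(1))

  have "word_representable \<lparr>pverts = pverts G1, parcs = parcs G1'\<rparr>"
    using word_representable_add_isolated[OF G1'(3) wf G1.pair_finite_verts] sub
    by (simp add: Un_absorb1)
  \<comment> \<open>A common bound for the thresholds of all vertices lets a single word have room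
    for every supervertex.\<close>
  then obtain w where w: "represents w \<lparr>pverts = pverts G1, parcs = parcs G1'\<rparr>"
    and "\<forall>v\<in>pverts G1. Max (N ` pverts G1) \<le> count_list w v"
    using ex_represents_count_ge by (fastforce simp: word_representable_def)
  then have count: "N v \<le> count_list w v" if "v \<in> pverts G1" for v
    using that G1.pair_finite_verts by (meson Max_ge finite_imageI image_eqI order_trans)
  have set_w: "set w = pverts G1"
    using w by (simp add: represents_def)
  have disj: "disjoint_family_on (supervertex G2) (set w)"
    by (auto simp: disjoint_family_on_def supervertex_def)

  have "represents (inflate P w) S"
    unfolding represents_def
  proof (intro conjI ballI impI)
    show "set (inflate P w) = pverts S"
      using set_inflate[of w P "supervertex G2"] P(2) by (auto simp: S set_w supervertex_def)
  next
    fix x y assume "x \<in> pverts S" "y \<in> pverts S" "x \<noteq> y"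
    then obtain i j where ij: "i \<in> pverts G1" "j \<in> pverts G1"
      and x: "x \<in> supervertex G2 i" and y: "y \<in> supervertex G2 j"
      by (auto simp: S supervertex_def)
    show "(x, y) \<in> parcs S \<longleftrightarrow> alternate (inflate P w) x y"
    proof (cases "i = j")
      case True
      \<comment> \<open>As \<open>G1'\<close> has no loops, the lexicographic map has no edges
        inside a supervertex.\<close>
      have "(x, y) \<in> parcs S \<longleftrightarrow> (x, y) \<in> parcs (F i)"
      proof -
        have "(x, y) \<in> parcs (F v) \<longleftrightarrow> v = i \<and> (x, y) \<in> parcs (F i)" if "v \<in> pverts G1" for v
          using F_arcs[OF that] x by (auto simp: supervertex_def)
        moreover have "(x, y) \<notin> supervertex G2 vi \<times> supervertex G2 vj"
          if "(vi, vj) \<in> parcs G1'" for vi vj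
          using that x y True by (auto simp: supervertex_def dest: G1'.no_loops')
        ultimately show ?thesis
          using ij(1) unfolding S by blast
      qed
      \<comment> \<open>The permutational representation is used with
        \<open>n = count_list w i\<close>.\<close>
      also have "\<dots> \<longleftrightarrow> alternate (inflate P w) x y"
        using PN[OF ij(1)] F(1)[OF ij(1)] count[OF ij(1)] y True
          alternate_inflate_same_block[of w P "supervertex G2" i x y] P disj x ij \<open>x \<noteq> y\<close>
        by (simp add: set_w permutationally_represents_def)
      finally show ?thesis .
    next
      case False
      \<comment> \<open>The added edges stay inside supervertices, so only the lexicographic map
        contributes here.\<close>
      have "(x, y) \<in> parcs S \<longleftrightarrow> (i, j) \<in> parcs G1'"
      proof -
        have "(x, y) \<notin> parcs (F v)" if "v \<in> pverts G1" for v
          using F_arcs[OF that] x y False by (auto simp: supervertex_def)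
        moreover have "x \<in> supervertex G2 v \<longleftrightarrow> v = i" "y \<in> supervertex G2 v \<longleftrightarrow> v = j" for v
          using x y by (auto simp: supervertex_def)
        ultimately show ?thesis
          unfolding S by fastforce
      qed
      also have "\<dots> \<longleftrightarrow> alternate w i j"
        using w ij False by (auto simp: represents_def)
      also have "\<dots> \<longleftrightarrow> alternate (inflate P w) x y"
        using alternate_inflate_distinct_blocks[of w P "supervertex G2" i j x y]
          P disj x y ij False
        by (simp add: set_w)
      finally show ?thesis .
    qed
  qed
  then show ?thesis
    by (auto simp: word_representable_def)
qed

end
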